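(* Let $f,g,h:\mathbb{R}^n\to\mathbb{R}$ be quadratic functions, $f(x)=x^TAx+2a^Tx+a_0$, $g(x)=x^TBx+2b^Tx+b_0$, $h(x)=x^TCx+2c^Tx+c_0$, with $A,B,C\in\mathbb{R}^{n\times n}$ symmetric, $a,b,c\in\mathbb{R}^n$ and $a_0,b_0,c_0\in\mathbb{R}$. Suppose that Assumptions 1, 2, 3, 4 and 5 (stated in the context) hold and that neither $g$ nor $h$ is affine. Then, for any given $\gamma\in\mathbb{R}$, the following two statements are equivalent: $(\mathrm{S}_1)$ For all $x\in\mathbb{R}^n$: $\big(g(x)\le 0$ and $h(x)\le 0\big)\Longrightarrow f(x)\ge\gamma$. $(\mathrm{S}_2)$ There exist $\lambda_1\ge 0$ and $\lambda_2\ge 0$ such that $f(x)-\gamma+\lambda_1 g(x)+\lambda_2 h(x)\ge 0$ for all $x\in\mathbb{R}^n$.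
   Context: For $\phi:\mathbb{R}^n\to\mathbb{R}$ and $\star\in\{<,\le,=,\ge,>\}$ write $\{\phi\star 0\}=\{x\in\mathbb{R}^n:\phi(x)\star 0\}$. A quadratic function is one of the form $x^TMx+2m^Tx+m_0$ with $M$ a symmetric matrix (possibly indefinite, possibly zero); it is affine if $M=0$. Let $\mathcal{D}=\{g\le 0\}\cap\{h\le 0\}$. Assumption 1: if $\mathcal{D}\subset\{g=0\}$ then $\mathcal{D}=\{g=0\}$; and if $\mathcal{D}\subset\{h=0\}$ then $\mathcal{D}=\{h=0\}$. Assumption 2: either $\{g=0\}\subset\{h\le 0\}$ or $\{g=0\}\subset\{h\ge 0\}$; and either $\{h=0\}\subset\{g\le 0\}$ or $\{h=0\}\subset\{g\ge 0\}$. Assumption 3: $f,g,h$ are non-constant functions, and $\mathcal{D}\neq\emptyset$, $\mathcal{D}\neq\{g\le 0\}$, $\mathcal{D}\neq\{h\le 0\}$. Assumption 4: each of the functions $g,h,-g,-h$ satisfies Slater's condition, i.e. takes a strictly negative value at some point (so $g$ and $h$ each take both positive and negative values). Assumption 5: if, after a coordinate transformation (invertible affine change of variables), $g,h$ become functions of a single variable $x_1\in\mathbb{R}$, one of them of the form $-x_1^2+1$ and the other of the form $\bar c_1x_1+\bar c_0$ with $\bar c_1>0$, then $\bar c_0\neq\pm\bar c_1$. *)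

theory Defs
  imports "HOL-Analysis.Analysis"
begin

definition quadratic_fun :: "real^'n^'n \<Rightarrow> real^'n \<Rightarrow> real \<Rightarrow> real^'n \<Rightarrow> real" where
  "quadratic_fun M m m0 x = x \<bullet> (M *v x) + 2 * (m \<bullet> x) + m0"

definition feasible_set :: "(real^'n \<Rightarrow> real) \<Rightarrow> (real^'n \<Rightarrow> real) \<Rightarrow> (real^'n) set" where
  "feasible_set g h = {x. g x \<le> 0} \<inter> {x. h x \<le> 0}"

definition slater :: "(real^'n \<Rightarrow> real) \<Rightarrow> bool" where
  "slater \<phi> \<longleftrightarrow> (\<exists>x. \<phi> x < 0)"

definition assumption1 :: "(real^'n \<Rightarrow> real) \<Rightarrow> (real^'n \<Rightarrow> real) \<Rightarrow> bool" where
  "assumption1 g h \<longleftrightarrow>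
     (feasible_set g h \<subseteq> {x. g x = 0} \<longrightarrow> feasible_set g h = {x. g x = 0}) \<and>
     (feasible_set g h \<subseteq> {x. h x = 0} \<longrightarrow> feasible_set g h = {x. h x = 0})"

definition assumption2 :: "(real^'n \<Rightarrow> real) \<Rightarrow> (real^'n \<Rightarrow> real) \<Rightarrow> bool" where
  "assumption2 g h \<longleftrightarrow>
     ({x. g x = 0} \<subseteq> {x. h x \<le> 0} \<or> {x. g x = 0} \<subseteq> {x. h x \<ge> 0}) \<and>
     ({x. h x = 0} \<subseteq> {x. g x \<le> 0} \<or> {x. h x = 0} \<subseteq> {x. g x \<ge> 0})"

definition assumption3 ::
  "(real^'n \<Rightarrow> real) \<Rightarrow> (real^'n \<Rightarrow> real) \<Rightarrow> (real^'n \<Rightarrow> real) \<Rightarrow> bool" where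
  "assumption3 f g h \<longleftrightarrow>
     \<not> f constant_on UNIV \<and> \<not> g constant_on UNIV \<and> \<not> h constant_on UNIV \<and>
     feasible_set g h \<noteq> {} \<and>
     feasible_set g h \<noteq> {x. g x \<le> 0} \<and>
     feasible_set g h \<noteq> {x. h x \<le> 0}"

definition assumption4 :: "(real^'n \<Rightarrow> real) \<Rightarrow> (real^'n \<Rightarrow> real) \<Rightarrow> bool" where
  "assumption4 g h \<longleftrightarrow>
     slater g \<and> slater h \<and> slater (\<lambda>x. - g x) \<and> slater (\<lambda>x. - h x)"

(* The index type carries no order, so the distinguished coordinate x_1 is an arbitrary
   coordinate k. Nothing changes, since P can absorb any permutation of the coordinates. *)
definition parabola_line_form ::
  "(real^'n \<Rightarrow> real) \<Rightarrow> (real^'n \<Rightarrow> real) \<Rightarrow> real^'n^'n \<Rightarrow> real^'n \<Rightarrow> 'n \<Rightarrow> real \<Rightarrow> real \<Rightarrow> bool" where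
  "parabola_line_form \<phi> \<psi> P p k c1 c0 \<longleftrightarrow>
     (\<forall>y. \<phi> (P *v y + p) = - (y $ k)\<^sup>2 + 1) \<and>
     (\<forall>y. \<psi> (P *v y + p) = c1 * y $ k + c0)"

definition assumption5 :: "(real^'n \<Rightarrow> real) \<Rightarrow> (real^'n \<Rightarrow> real) \<Rightarrow> bool" where
  "assumption5 g h \<longleftrightarrow>
     (\<forall>P p k c1 c0.
        invertible P \<and> c1 > 0 \<and>
        (parabola_line_form g h P p k c1 c0 \<or> parabola_line_form h g P p k c1 c0) \<longrightarrow>
        c0 \<noteq> c1 \<and> c0 \<noteq> - c1)"

end

theory Submission imports Defs begin

text \<open>
  The proof rests on the S-lemma with equality: if \<open>g\<close> is not affine and takes both signs, then
  \<open>f \<ge> 0\<close> on \<open>{g = 0}\<close> forces \<open>f + \<lambda> g \<ge> 0\<close> for some real \<open>\<lambda>\<close>. For quadratic forms this is Finsler's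
  lemma, and a recession argument at infinity reduces the inhomogeneous case to it.

  Applied to \<open>g\<close> and \<open>\<plusminus>h\<close>, it gives \<open>\<mu> > 0\<close> such that \<open>h + \<mu> g\<close> has constant sign. If
  \<open>h + \<mu> g \<ge> 0\<close>, then the feasible set is \<open>{g = 0}\<close>; the S-lemma yields a multiplier \<open>\<lambda>\<close> for \<open>g\<close>, and
  adding a large multiple of \<open>h + \<mu> g\<close> makes it nonnegative. If \<open>h + \<mu> g \<le> 0\<close>, then \<open>{g = 0}\<close> and
  \<open>{h = 0}\<close> are both feasible, so \<open>f - \<gamma> + \<alpha> g \<ge> 0\<close> and \<open>f - \<gamma> + \<beta> h \<ge> 0\<close> for some \<open>\<alpha>\<close>, \<open>\<beta>\<close>. If both
  are negative, then \<open>f \<ge> \<gamma>\<close> also on \<open>{g \<ge> 0}\<close> and \<open>{h \<ge> 0}\<close>, hence everywhere.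
\<close>

lemma symmetric_matrix_dot_commute:
  fixes M :: "real^'n^'n"
  assumes "transpose M = M"
  shows "x \<bullet> (M *v y) = y \<bullet> (M *v x)"
  by (metis assms dot_lmul_matrix inner_commute transpose_matrix_vector)

lemma quadratic_fun_line:
  fixes M :: "real^'n^'n"
  assumes "transpose M = M"
  shows "quadratic_fun M m m0 (x + s *\<^sub>R d)
    = quadratic_fun M m m0 x + 2 * s * (d \<bullet> (M *v x + m)) + s\<^sup>2 * (d \<bullet> (M *v d))"
  using symmetric_matrix_dot_commute[OF assms, of x d]
  by (simp add: quadratic_fun_def matrix_vector_right_distrib matrix_vector_mult_scaleR
      inner_add_left inner_add_right inner_commute[of m] power2_eq_square algebra_simps)

lemma continuous_on_quadratic_fun [continuous_intros]:
  fixes M :: "real^'n^'n"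
  assumes "continuous_on S p"
  shows "continuous_on S (\<lambda>x. quadratic_fun M m m0 (p x))"
  unfolding quadratic_fun_def
  by (intro continuous_intros assms
      bounded_linear.continuous_on[OF matrix_vector_mul_bounded_linear])

lemma symmetric_matrix_eq_0:
  fixes M :: "real^'n^'n"
  assumes sym: "transpose M = M" and zero: "\<And>u. u \<bullet> (M *v u) = 0"
  shows "M = 0"
proof -
  have "x \<bullet> (M *v y) = 0" for x y
    using zero[of "x + y"] zero[of x] zero[of y] symmetric_matrix_dot_commute[OF sym, of x y]
    by (simp add: matrix_vector_right_distrib inner_add_left inner_add_right)
  then have "M *v y = 0" for y
    by (metis inner_eq_zero_iff)
  then show ?thesis
    by (simp add: matrix_eq)
qed

section \<open>Limits at infinity along the zero set\<close>

lemma continuous_nonneg_at_0: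
  fixes p :: "real \<Rightarrow> real"
  assumes "continuous_on UNIV p" and "\<And>t. t \<noteq> 0 \<Longrightarrow> p t \<ge> 0"
  shows "p 0 \<ge> 0"
proof -
  have "(p \<longlongrightarrow> p 0) (at 0)"
    using assms(1) by (simp add: continuous_on_eq_continuous_at isCont_def)
  then show ?thesis
    by (rule tendsto_lowerbound) (auto simp: eventually_at_filter assms(2))
qed

text \<open>Substituting \<open>s = 1/t\<close> and multiplying by \<open>t^2\<close> turns the
  leading coefficient into the value at \<open>t = 0\<close>, so continuity decides.\<close>

lemma quadratic_polynomial_nonneg_imp_lead_nonneg:
  fixes p q r :: real
  assumes "\<And>s. p + 2 * s * q + s\<^sup>2 * r \<ge> 0"
  shows "r \<ge> 0"
proof -
  have "t\<^sup>2 * p + 2 * t * q + r \<ge> 0" if "t \<noteq> 0" for t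
  proof -
    have "t\<^sup>2 * p + 2 * t * q + r = t\<^sup>2 * (p + 2 * (1/t) * q + (1/t)\<^sup>2 * r)"
      using that by (simp add: field_simps power2_eq_square)
    also have "\<dots> \<ge> 0"
      by (intro mult_nonneg_nonneg assms) simp
    finally show ?thesis .
  qed
  moreover have "continuous_on UNIV (\<lambda>t. t\<^sup>2 * p + 2 * t * q + r)"
    by (intro continuous_intros)
  ultimately show ?thesis
    using continuous_nonneg_at_0[of "\<lambda>t. t\<^sup>2 * p + 2 * t * q + r"] by simp
qed

text \<open>The function with matrix \<open>B\<close> is affine along every line parallel to
  \<open>d\<close>. This allows points of its zero set to escape to infinity with \<open>d\<close>
  as the dominant direction; there the other function, suitably rescaled, tends to a positive
  multiple of its form at \<open>d\<close>.\<close>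

lemma quadratic_fun_nonneg_recession:
  fixes A B :: "real^'n^'n"
  assumes symA: "transpose A = A" and symB: "transpose B = B" and "B \<noteq> 0"
    and neg: "quadratic_fun B b b0 x1 < 0" and pos: "quadratic_fun B b b0 x2 > 0"
    and nonneg: "\<And>x. quadratic_fun B b b0 x = 0 \<Longrightarrow> quadratic_fun A a a0 x \<ge> 0"
    and d: "d \<bullet> (B *v d) = 0"
  shows "d \<bullet> (A *v d) \<ge> 0"
proof -
  define f where "f = quadratic_fun A a a0"
  define g where "g = quadratic_fun B b b0"
  note line_f = quadratic_fun_line[OF symA, of a a0, folded f_def]
  note line_g = quadratic_fun_line[OF symB, of b b0, folded g_def]
  have fg: "f x \<ge> 0" if "g x = 0" for x
    using nonneg that by (simp add: f_def g_def)
  have on_line: ?thesis if "g y = 0" "d \<bullet> (B *v y + b) = 0" for y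
  proof (rule quadratic_polynomial_nonneg_imp_lead_nonneg)
    fix s
    have "g (y + s *\<^sub>R d) = 0"
      using that d by (simp add: line_g)
    then show "f y + 2 * s * (d \<bullet> (A *v y + a)) + s\<^sup>2 * (d \<bullet> (A *v d)) \<ge> 0"
      using fg line_f by metis
  qed
  \<comment> \<open>The slope of \<open>g\<close> along \<open>d\<close> at \<open>y\<close> is
    twice \<open>d \<bullet> (B *v y + b)\<close>. In the three cases it is identically zero, a
    nonzero constant, or dependent on \<open>y\<close>.\<close>
  consider "B *v d = 0" "d \<bullet> b = 0" | "B *v d = 0" "d \<bullet> b \<noteq> 0" | "B *v d \<noteq> 0"
    by blast
  then show ?thesis
  proof cases
    case 1
    have "connected (range g)"
      unfolding g_def by (intro connected_continuous_image continuous_intros connected_UNIV)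
    then have "0 \<in> range g"
      using connectedD_interval[of "range g" "g x1" "g x2" 0] neg pos by (auto simp: g_def)
    then obtain y where "g y = 0"
      by auto
    moreover have "d \<bullet> (B *v y + b) = 0"
      using 1 symmetric_matrix_dot_commute[OF symB, of d y] by (simp add: inner_add_right)
    ultimately show ?thesis
      by (rule on_line)
  next
    case 2
    define \<beta> where "\<beta> = d \<bullet> b"
    have \<beta>: "\<beta> \<noteq> 0"
      using 2 by (simp add: \<beta>_def)
    have dB: "d \<bullet> (B *v y + b) = \<beta>" for y
      using 2 symmetric_matrix_dot_commute[OF symB, of d y] by (simp add: inner_add_right \<beta>_def)
    obtain u where u: "u \<bullet> (B *v u) \<noteq> 0"
      using symmetric_matrix_eq_0[OF symB] \<open>B \<noteq> 0\<close> by blast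
    \<comment> \<open>\<open>\<sigma> e / e\<^sup>2\<close> is the step along \<open>d\<close> that leads from \<open>u / e\<close> to \<open>{g = 0}\<close>; it is of order
      \<open>1 / e\<^sup>2\<close> because \<open>u \<bullet> B u \<noteq> 0\<close>, so the \<open>d\<close>-component dominates.\<close>
    define \<sigma> where "\<sigma> e = - (u \<bullet> (B *v u) + 2 * e * (b \<bullet> u) + e\<^sup>2 * b0) / (2 * \<beta>)" for e
    \<comment> \<open>This is \<open>f\<close> at the point reached, times \<open>e^4\<close>,
      expanded as a polynomial in \<open>e\<close>; only the \<open>d\<close>-term survives at
      \<open>e = 0\<close>.\<close>
    define p where "p e = e\<^sup>2 * (u \<bullet> (A *v u) + 2 * e * (a \<bullet> u) + e\<^sup>2 * a0)
      + 2 * \<sigma> e * (e * (d \<bullet> (A *v u)) + e\<^sup>2 * (d \<bullet> a)) + (\<sigma> e)\<^sup>2 * (d \<bullet> (A *v d))" for e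
    have "p 0 \<ge> 0"
    proof (rule continuous_nonneg_at_0)
      show "continuous_on UNIV p"
        unfolding p_def \<sigma>_def using \<beta> by (intro continuous_intros) auto
      fix e :: real
      assume e: "e \<noteq> 0"
      define x where "x = (1 / e) *\<^sub>R u + (\<sigma> e / e\<^sup>2) *\<^sub>R d"
      have "g x = 0"
        using e \<beta> unfolding x_def line_g dB d
        by (simp add: g_def quadratic_fun_def \<sigma>_def matrix_vector_mult_scaleR field_simps
            power2_eq_square)
      moreover have "p e = e^4 * f x"
        using e unfolding x_def line_f
        by (simp add: f_def quadratic_fun_def p_def matrix_vector_mult_scaleR inner_add_right
            field_simps power2_eq_square power4_eq_xxxx)
      ultimately show "p e \<ge> 0"
        using fg by simp
    qed
    moreover have "\<sigma> 0 \<noteq> 0"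
      using u \<beta> by (simp add: \<sigma>_def)
    ultimately show ?thesis
      by (simp add: p_def zero_le_mult_iff)
  next
    case 3
    define w where "w = B *v d"
    have w: "w \<bullet> w \<noteq> 0"
      using 3 by (simp add: w_def)
    have dB: "d \<bullet> (B *v y) = w \<bullet> y" for y
      using symmetric_matrix_dot_commute[OF symB, of d y] by (simp add: w_def inner_commute)
    \<comment> \<open>The multiple of \<open>w\<close> at which the slope of \<open>g\<close> along
      \<open>d\<close> vanishes.\<close>
    define y where "y = (- (d \<bullet> b) / (w \<bullet> w)) *\<^sub>R w"
    have y: "d \<bullet> (B *v y + b) = 0"
      using w by (simp add: inner_add_right dB y_def)
    show ?thesis
    proof (cases "g y = 0")
      case True
      then show ?thesis
        using y by (rule on_line)
    next
      case False
      define v where "v \<tau> = y + \<tau> *\<^sub>R w" for \<tau>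
      define \<sigma> where "\<sigma> \<tau> = - g (v \<tau>) / (2 * (w \<bullet> w))" for \<tau>
      \<comment> \<open>Near \<open>y\<close> the step along \<open>d\<close> that leads to \<open>{g = 0}\<close> is \<open>\<sigma> \<tau> / \<tau>\<close>, which tends to infinity.\<close>
      define p where "p \<tau> = \<tau>\<^sup>2 * f (v \<tau>) + 2 * \<tau> * \<sigma> \<tau> * (d \<bullet> (A *v v \<tau> + a))
        + (\<sigma> \<tau>)\<^sup>2 * (d \<bullet> (A *v d))" for \<tau>
      have "p 0 \<ge> 0"
      proof (rule continuous_nonneg_at_0)
        show "continuous_on UNIV p"
          unfolding p_def \<sigma>_def v_def f_def g_def using w
          by (intro continuous_intros
              bounded_linear.continuous_on[OF matrix_vector_mul_bounded_linear]) auto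
        fix \<tau> :: real
        assume \<tau>: "\<tau> \<noteq> 0"
        define x where "x = v \<tau> + (\<sigma> \<tau> / \<tau>) *\<^sub>R d"
        have "d \<bullet> (B *v v \<tau> + b) = \<tau> * (w \<bullet> w)"
          using y by (simp add: v_def inner_add_right dB)
        then have "g x = 0"
          using \<tau> w d unfolding x_def line_g by (simp add: \<sigma>_def)
        moreover have "p \<tau> = \<tau>\<^sup>2 * f x"
          using \<tau> unfolding x_def line_f by (simp add: p_def field_simps power2_eq_square)
        ultimately show "p \<tau> \<ge> 0"
          using fg by simp
      qed
      moreover have "\<sigma> 0 \<noteq> 0"
        using False w by (simp add: \<sigma>_def v_def)
      ultimately show ?thesis
        by (simp add: p_def zero_le_mult_iff)
    qed
  qed
qed

section \<open>Finsler's lemma\<close>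

lemma opposite_sign_roots:
  fixes p q r :: real
  assumes "p > 0" and "q > 0"
  obtains s t where "s > 0" "t > 0" "p + s * r - s\<^sup>2 * q = 0" "p - t * r - t\<^sup>2 * q = 0"
    "q * s * t = p"
proof -
  define D where "D = sqrt (r\<^sup>2 + 4 * p * q)"
  have D2: "D\<^sup>2 = r\<^sup>2 + 4 * p * q"
    unfolding D_def using assms by simp
  have "\<bar>r\<bar> < D"
    unfolding D_def using assms by (intro real_less_rsqrt) simp
  show ?thesis
  proof (rule that[of "(D + r) / (2 * q)" "(D - r) / (2 * q)"])
    show "(D + r) / (2 * q) > 0" "(D - r) / (2 * q) > 0"
      using \<open>\<bar>r\<bar> < D\<close> assms by auto
    \<comment> \<open>Eliminating \<open>p\<close> turns the three goals into rational identities in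
      \<open>D\<close>, \<open>r\<close> and \<open>q\<close>.\<close>
    have p: "p = (D\<^sup>2 - r\<^sup>2) / (4 * q)"
      using D2 assms by simp
    show "p + (D + r) / (2 * q) * r - ((D + r) / (2 * q))\<^sup>2 * q = 0"
      "p - (D - r) / (2 * q) * r - ((D - r) / (2 * q))\<^sup>2 * q = 0"
      "q * ((D + r) / (2 * q)) * ((D - r) / (2 * q)) = p"
      using assms unfolding p by (simp_all add: field_simps power2_eq_square)
  qed
qed

text \<open>Points with \<open>G > 0\<close> bound \<open>l\<close> from below by
  \<open>- F x / G x\<close>, points with \<open>G < 0\<close> from above. Each lower bound is at
  most each upper bound because the line through \<open>x\<close> in direction \<open>y\<close>
  meets \<open>G = 0\<close> on both sides of \<open>x\<close>; so the supremum of the lower bounds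
  works.\<close>

lemma Finsler_lemma:
  fixes F G :: "'a::real_vector \<Rightarrow> real" and F' G' :: "'a \<Rightarrow> 'a \<Rightarrow> real"
  assumes F: "\<And>x y s. F (x + s *\<^sub>R y) = F x + s * F' x y + s\<^sup>2 * F y"
    and G: "\<And>x y s. G (x + s *\<^sub>R y) = G x + s * G' x y + s\<^sup>2 * G y"
    and nonneg: "\<And>x. G x = 0 \<Longrightarrow> F x \<ge> 0"
    and neg: "G x1 < 0" and pos: "G x2 > 0"
  shows "\<exists>l. \<forall>x. F x + l * G x \<ge> 0"
proof -
  have cross: "- F x / G x \<le> - F y / G y" if x: "G x > 0" and y: "G y < 0" for x y
  proof -
    obtain s t where st: "s > 0" "t > 0" "G x + s * G' x y - s\<^sup>2 * (- G y) = 0"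
      "G x - t * G' x y - t\<^sup>2 * (- G y) = 0" "- G y * s * t = G x"
      using opposite_sign_roots[of "G x" "- G y" "G' x y"] x y by auto
    have "F (x + s *\<^sub>R y) \<ge> 0" "F (x + (- t) *\<^sub>R y) \<ge> 0"
      using st by (auto intro!: nonneg simp: G simp del: scaleR_minus_left)
    then have "F x + s * F' x y + s\<^sup>2 * F y \<ge> 0" "F x - t * F' x y + t\<^sup>2 * F y \<ge> 0"
      by (simp_all add: F del: scaleR_minus_left)
    \<comment> \<open>The weights \<open>t\<close> and \<open>s\<close> cancel the cross term
      \<open>F' x y\<close>.\<close>
    then have "0 \<le> t * (F x + s * F' x y + s\<^sup>2 * F y) + s * (F x - t * F' x y + t\<^sup>2 * F y)"
      using st(1,2) by simp
    also have "t * (F x + s * F' x y + s\<^sup>2 * F y) + s * (F x - t * F' x y + t\<^sup>2 * F y)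
        = (s + t) * (F x + s * t * F y)"
      by (simp add: algebra_simps power2_eq_square)
    finally have "F x + s * t * F y \<ge> 0"
      using st(1,2) by (simp add: zero_le_mult_iff)
    moreover have "s * t = - G x / G y"
      using st(5) y by (simp add: field_simps)
    ultimately show ?thesis
      using x y by (simp add: field_simps)
  qed
  define S where "S = {- F x / G x |x. G x > 0}"
  have upper: "l \<le> - F y / G y" if "l \<in> S" "G y < 0" for l y
    using that cross by (auto simp: S_def)
  have "S \<noteq> {}"
    using pos by (auto simp: S_def)
  have bdd: "bdd_above S"
    using upper neg by (meson bdd_aboveI)
  have "F x + Sup S * G x \<ge> 0" for x
  proof (cases "G x" "0::real" rule: linorder_cases)
    case less
    then have "Sup S \<le> - F x / G x"
      using upper \<open>S \<noteq> {}\<close> by (auto intro: cSup_least)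
    then show ?thesis
      using less by (simp add: field_simps)
  next
    case equal
    then show ?thesis
      using nonneg by simp
  next
    case greater
    then have "- F x / G x \<le> Sup S"
      using bdd by (auto intro!: cSup_upper simp: S_def)
    then show ?thesis
      using greater by (simp add: field_simps)
  qed
  then show ?thesis
    by blast
qed

text \<open>Pairing with \<open>real\<close> adds the homogenizing coordinate without a new index
  type; \<open>snd z = 0\<close> is the hyperplane at infinity.\<close>

definition homogenization :: "real^'n^'n \<Rightarrow> real^'n \<Rightarrow> real \<Rightarrow> (real^'n) \<times> real \<Rightarrow> real" where
  "homogenization M m m0 z = fst z \<bullet> (M *v fst z) + 2 * snd z * (m \<bullet> fst z) + m0 * (snd z)\<^sup>2"

lemma homogenization_line:
  "homogenization M m m0 (z + s *\<^sub>R w) = homogenization M m m0 z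
    + s * (fst z \<bullet> (M *v fst w) + fst w \<bullet> (M *v fst z)
           + 2 * (snd z * (m \<bullet> fst w) + snd w * (m \<bullet> fst z)) + 2 * m0 * snd z * snd w)
    + s\<^sup>2 * homogenization M m m0 w"
  by (simp add: homogenization_def matrix_vector_right_distrib matrix_vector_mult_scaleR
      inner_add_left inner_add_right power2_eq_square algebra_simps)

lemma homogenization_eq_quadratic_fun:
  assumes "t \<noteq> 0"
  shows "homogenization M m m0 (x, t) = t\<^sup>2 * quadratic_fun M m m0 ((1 / t) *\<^sub>R x)"
  using assms
  by (simp add: homogenization_def quadratic_fun_def matrix_vector_mult_scaleR field_simps
      power2_eq_square)

text \<open>Finsler's lemma for the homogenizations: finite points follow by rescaling, points at
  infinity from the recession lemma. An affine constraint would break it: on the real line,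
  \<open>- x^2\<close> is nonnegative on \<open>x = 0\<close>, but no multiple of \<open>x\<close>
  makes it nonnegative everywhere.\<close>

lemma S_lemma_equality:
  fixes A B :: "real^'n^'n"
  assumes symA: "transpose A = A" and symB: "transpose B = B" and "B \<noteq> 0"
    and neg: "quadratic_fun B b b0 x1 < 0" and pos: "quadratic_fun B b b0 x2 > 0"
    and nonneg: "\<And>x. quadratic_fun B b b0 x = 0 \<Longrightarrow> quadratic_fun A a a0 x \<ge> 0"
  shows "\<exists>l. \<forall>x. quadratic_fun A a a0 x + l * quadratic_fun B b b0 x \<ge> 0"
proof -
  have at_1: "homogenization M m m0 (x, 1) = quadratic_fun M m m0 x"
    for M :: "real^'n^'n" and m m0 x
    by (simp add: homogenization_eq_quadratic_fun)
  have "\<exists>l. \<forall>z. homogenization A a a0 z + l * homogenization B b b0 z \<ge> 0"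
  proof (rule Finsler_lemma[OF homogenization_line homogenization_line])
    show "homogenization B b b0 (x1, 1) < 0" "homogenization B b b0 (x2, 1) > 0"
      using neg pos by (simp_all add: at_1)
    fix z
    assume z: "homogenization B b b0 z = 0"
    show "homogenization A a a0 z \<ge> 0"
    proof (cases "snd z = 0")
      case True
      have "fst z \<bullet> (A *v fst z) \<ge> 0"
        using z True
        by (intro quadratic_fun_nonneg_recession[OF symA symB \<open>B \<noteq> 0\<close> neg pos nonneg])
          (simp_all add: homogenization_def)
      then show ?thesis
        using True by (simp add: homogenization_def)
    next
      case False
      then show ?thesis
        using z nonneg homogenization_eq_quadratic_fun[OF False, of _ _ _ "fst z"] by simp
    qed
  qed
  then show ?thesis
    by (metis at_1)
qed

theorem theorem4p2:
  fixes f g h :: "real^'n \<Rightarrow> real"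
    and A B C :: "real^'n^'n"
    and a b c :: "real^'n"
    and a0 b0 c0 \<gamma> :: real
  assumes "transpose A = A" and "transpose B = B" and "transpose C = C"
    and "f = quadratic_fun A a a0"
    and "g = quadratic_fun B b b0"
    and "h = quadratic_fun C c c0"
    and "assumption1 g h"
    and "assumption2 g h"
    and "assumption3 f g h"
    and "assumption4 g h"
    and "assumption5 g h"
    and "B \<noteq> 0" and "C \<noteq> 0"
  shows "(\<forall>x. g x \<le> 0 \<and> h x \<le> 0 \<longrightarrow> f x \<ge> \<gamma>) \<longleftrightarrow>
    (\<exists>l1\<ge>0. \<exists>l2\<ge>0. \<forall>x. f x - \<gamma> + l1 * g x + l2 * h x \<ge> 0)"
proof
  assume "\<exists>l1\<ge>0. \<exists>l2\<ge>0. \<forall>x. f x - \<gamma> + l1 * g x + l2 * h x \<ge> 0"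
  then obtain l1 l2 where l: "l1 \<ge> 0" "l2 \<ge> 0" "\<And>x. f x - \<gamma> + l1 * g x + l2 * h x \<ge> 0"
    by blast
  show "\<forall>x. g x \<le> 0 \<and> h x \<le> 0 \<longrightarrow> f x \<ge> \<gamma>"
  proof (intro allI impI)
    fix x
    assume "g x \<le> 0 \<and> h x \<le> 0"
    then have "l1 * g x \<le> 0" "l2 * h x \<le> 0"
      using l(1,2) by (simp_all add: mult_nonneg_nonpos)
    then show "f x \<ge> \<gamma>"
      using l(3)[of x] by linarith
  qed
next
  assume S1: "\<forall>x. g x \<le> 0 \<and> h x \<le> 0 \<longrightarrow> f x \<ge> \<gamma>"
  obtain g1 g2 h1 h2 where signs: "g g1 < 0" "g g2 > 0" "h h1 < 0" "h h2 > 0"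
    using \<open>assumption4 g h\<close> by (auto simp: assumption4_def slater_def)
  have f\<gamma>: "f x - \<gamma> = quadratic_fun A a (a0 - \<gamma>) x" for x
    by (simp add: \<open>f = _\<close> quadratic_fun_def)
  have h_neg: "- h x = quadratic_fun (- C) (- c) (- c0) x" for x
    using matrix_vector_mult_diff_rdistrib[of 0 C x] by (simp add: \<open>h = _\<close> quadratic_fun_def)
  have symC': "transpose (- C) = - C"
    using \<open>transpose C = C\<close> by (simp add: transpose_def vec_eq_iff)
  have S_g: "\<exists>l. \<forall>x. quadratic_fun M m m0 x + l * g x \<ge> 0"
    if "transpose M = M" "\<And>x. g x = 0 \<Longrightarrow> quadratic_fun M m m0 x \<ge> 0" for M m m0
    using S_lemma_equality[OF that(1) \<open>transpose B = B\<close> \<open>B \<noteq> 0\<close>] signs(1,2) that(2)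
    unfolding \<open>g = _\<close> by blast
  have S_h: "\<exists>l. \<forall>x. quadratic_fun M m m0 x + l * h x \<ge> 0"
    if "transpose M = M" "\<And>x. h x = 0 \<Longrightarrow> quadratic_fun M m m0 x \<ge> 0" for M m m0
    using S_lemma_equality[OF that(1) \<open>transpose C = C\<close> \<open>C \<noteq> 0\<close>] signs(3,4) that(2)
    unfolding \<open>h = _\<close> by blast
  have mult_g: "\<exists>l. \<forall>x. f x - \<gamma> + l * g x \<ge> 0" if "\<And>x. g x = 0 \<Longrightarrow> h x \<le> 0"
    using S_g[OF \<open>transpose A = A\<close>, of a "a0 - \<gamma>", folded f\<gamma>] S1 that by simp
  have not_subset: "\<not> (\<forall>x. g x \<le> 0 \<longrightarrow> h x \<le> 0)" "\<not> (\<forall>x. h x \<le> 0 \<longrightarrow> g x \<le> 0)"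
    using \<open>assumption3 f g h\<close> by (auto simp: assumption3_def feasible_set_def)
  consider \<mu> where "\<mu> > 0" "\<And>x. h x + \<mu> * g x \<ge> 0" | \<mu> where "\<mu> > 0" "\<And>x. h x + \<mu> * g x \<le> 0"
  proof -
    have "(\<forall>x. g x = 0 \<longrightarrow> h x \<le> 0) \<or> (\<forall>x. g x = 0 \<longrightarrow> h x \<ge> 0)"
      using \<open>assumption2 g h\<close> by (auto simp: assumption2_def)
    then show ?thesis
    proof
      assume "\<forall>x. g x = 0 \<longrightarrow> h x \<le> 0"
      then obtain l where l: "- h x + l * g x \<ge> 0" for x
        using S_g[OF symC', of "- c" "- c0", folded h_neg] by auto
      \<comment> \<open>With \<open>l \<ge> 0\<close>, \<open>h \<le> l * g\<close> would put
        \<open>{g \<le> 0}\<close> inside \<open>{h \<le> 0}\<close>.\<close>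
      have "l < 0"
      proof (rule ccontr)
        assume "\<not> l < 0"
        then have "h x \<le> 0" if "g x \<le> 0" for x
          using l[of x] that mult_nonneg_nonpos[of l "g x"] by linarith
        then show False
          using not_subset(1) by blast
      qed
      then show ?thesis
        using l that(2)[of "- l"] by (simp add: algebra_simps)
    next
      assume "\<forall>x. g x = 0 \<longrightarrow> h x \<ge> 0"
      then obtain l where l: "h x + l * g x \<ge> 0" for x
        using S_g[OF \<open>transpose C = C\<close>, of c c0, folded \<open>h = _\<close>] by auto
      have "l > 0"
      proof (rule ccontr)
        assume "\<not> l > 0"
        \<comment> \<open>\<open>l = 0\<close> would make \<open>h\<close> nonnegative everywhere,
          against \<open>h h1 < 0\<close>; a negative \<open>l\<close> would put
          \<open>{h \<le> 0}\<close> inside \<open>{g \<le> 0}\<close>.\<close>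
        have "l \<noteq> 0"
          using l[of h1] signs(3) by auto
        have "g x \<le> 0" if "h x \<le> 0" for x
          using l[of x] that \<open>\<not> l > 0\<close> \<open>l \<noteq> 0\<close> mult_neg_pos[of l "g x"] by linarith
        then show False
          using not_subset(2) by blast
      qed
      then show ?thesis
        using l that(1) by blast
    qed
  qed
  then show "\<exists>l1\<ge>0. \<exists>l2\<ge>0. \<forall>x. f x - \<gamma> + l1 * g x + l2 * h x \<ge> 0"
  proof cases
    case (1 \<mu>)
    have "g x = 0" if "g x \<le> 0" "h x \<le> 0" for x
      using 1(2)[of x] that \<open>\<mu> > 0\<close> mult_pos_neg[of \<mu> "g x"] by linarith
    then have "feasible_set g h = {x. g x = 0}"
      using \<open>assumption1 g h\<close> by (auto simp: assumption1_def feasible_set_def)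
    then have "h x \<le> 0" if "g x = 0" for x
      using that by (auto simp: feasible_set_def)
    then obtain l where l: "f x - \<gamma> + l * g x \<ge> 0" for x
      using mult_g by blast
    \<comment> \<open>Chosen so that \<open>t * (h x + \<mu> * g x)\<close> contributes exactly
      \<open>\<bar>l\<bar>\<close> to the coefficient of \<open>g\<close>, making it
      nonnegative.\<close>
    define t where "t = \<bar>l\<bar> / \<mu>"
    have "f x - \<gamma> + (l + \<bar>l\<bar>) * g x + t * h x \<ge> 0" for x
    proof -
      have "t * (h x + \<mu> * g x) \<ge> 0"
        using 1 by (simp add: t_def)
      moreover have "t * \<mu> = \<bar>l\<bar>"
        using 1(1) by (simp add: t_def)
      then have "t * (h x + \<mu> * g x) = t * h x + \<bar>l\<bar> * g x"
        by (simp add: distrib_left mult.assoc [symmetric])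
      ultimately show ?thesis
        using l[of x] by (simp add: distrib_right)
    qed
    moreover have "l + \<bar>l\<bar> \<ge> 0" "t \<ge> 0"
      using 1(1) by (simp_all add: t_def)
    ultimately show ?thesis
      by blast
  next
    case (2 \<mu>)
    have h_le: "h x \<le> 0" if "g x \<ge> 0" for x
      using 2(2)[of x] that \<open>\<mu> > 0\<close> mult_nonneg_nonneg[of \<mu> "g x"] by linarith
    have g_le: "g x \<le> 0" if "h x \<ge> 0" for x
      using 2(2)[of x] that \<open>\<mu> > 0\<close> mult_pos_pos[of \<mu> "g x"] by linarith
    obtain \<alpha> where \<alpha>: "f x - \<gamma> + \<alpha> * g x \<ge> 0" for x
      using mult_g h_le by auto
    obtain \<beta> where \<beta>: "f x - \<gamma> + \<beta> * h x \<ge> 0" for x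
      using S_h[OF \<open>transpose A = A\<close>, of a "a0 - \<gamma>", folded f\<gamma>] S1 g_le by auto
    consider "\<alpha> \<ge> 0" | "\<beta> \<ge> 0" | "\<alpha> < 0" "\<beta> < 0"
      by linarith
    then show ?thesis
    proof cases
      case 1
      then show ?thesis
        using \<alpha> by (intro exI[of _ \<alpha>] conjI exI[of _ 0]) auto
    next
      case 2
      then show ?thesis
        using \<beta> by (intro exI[of _ 0] conjI exI[of _ \<beta>]) auto
    next
      case 3
      \<comment> \<open>Where \<open>g x > 0\<close> or \<open>h x > 0\<close>, the corresponding
        negative multiplier already forces the bound; elsewhere \<open>x\<close> is feasible. Both
        multipliers can then be 0.\<close>
      have "f x - \<gamma> \<ge> 0" for x
      proof -
        consider "g x \<le> 0" "h x \<le> 0" | "g x > 0" | "h x > 0"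
          by linarith
        then show ?thesis
        proof cases
          case 1
          then show ?thesis
            using S1 by simp
        next
          case 2
          then show ?thesis
            using \<alpha>[of x] mult_neg_pos[OF 3(1) 2] by linarith
        next
          case 3
          then show ?thesis
            using \<beta>[of x] mult_neg_pos[OF \<open>\<beta> < 0\<close> 3] by linarith
        qed
      qed
      then show ?thesis
        by (intro exI[of _ 0] conjI) auto
    qed
  qed
qed

end
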